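(* Consider a countable Markov chain on $\mathbb N_0$ whose transition matrix is a $(p+2)$-diagonal matrix of type II, $P_{II}$, admitting a positive stochastic bidiagonal factorization (or of type I, $P_I$, admitting the transposed version of such a factorization), and let $\{B_n\}$, $\{A^{(1)}_n,\dots,A^{(p)}_n\}$ and $\mathrm d\psi_1,\dots,\mathrm d\psi_p$ be the associated multiple orthogonal polynomials and positive measures on $[0,1]$. The Markov chain is ergodic (positive recurrent) if and only if $1$ is a mass point of $\mathrm d\psi_1,\mathrm d\psi_2,\dots,\mathrm d\psi_p$ with masses $m_1>0$ and $m_2,\dots,m_p\ge0$, respectively. In that case the corresponding stationary distribution is $$\pi=(\pi_1,\pi_2,\dots),\qquad \pi_{n+1}=\big(A^{(1)}_n(1)m_1+\cdots+A^{(p)}_n(1)m_p\big)B_n(1),\quad n\in\mathbb N_0 .$$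
   Context: Fix an integer $p\ge1$; matrices are semi-infinite, indexed by $\mathbb N_0=\{0,1,2,\dots\}$. A type II banded stochastic matrix $P_{II}=(P_{i,j})$ is a nonnegative matrix with row sums $1$ and $P_{i,j}=0$ if $j>i+1$ or $j<i-p$; a type I one, $P_I$, is a nonnegative matrix with row sums $1$ and $P_{i,j}=0$ if $j>i+p$ or $j<i-1$. Positive stochastic bidiagonal factorization of $P_{II}$: $P_{II}=\Pi_1\cdots\Pi_p\Upsilon$ with each $\Pi_a$ a lower bidiagonal stochastic matrix ($(\Pi_a)_{0,0}=1$, $(\Pi_a)_{k,k-1}+(\Pi_a)_{k,k}=1$, $(\Pi_a)_{k,k-1}>0$, $(\Pi_a)_{k,k}>0$ for $k\ge1$) and $\Upsilon$ an upper bidiagonal stochastic matrix ($\Upsilon_{k,k}+\Upsilon_{k,k+1}=1$, $\Upsilon_{k,k}>0$, $\Upsilon_{k,k+1}>0$). The transposed version for $P_I$: $P_I=\Pi\Upsilon_p\cdots\Upsilon_1$ with $\Pi$ a lower bidiagonal stochastic matrix ($\Pi_{0,0}=1$, $\Pi_{k,k-1}+\Pi_{k,k}=1$, $\Pi_{k,k-1}>0$, $\Pi_{k,k}>0$ for $k\ge1$) and each $\Upsilon_a$, $a\in\{1,\dots,p\}$, an upper bidiagonal stochastic matrix ($(\Upsilon_a)_{k,k}+(\Upsilon_a)_{k,k+1}=1$, $(\Upsilon_a)_{k,k}>0$, $(\Upsilon_a)_{k,k+1}>0$ for $k\ge0$). Associated monic Hessenberg matrix $T$: in the type II case, with $\pi_{II,0}=1$,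 $\pi_{II,n}=\frac1{P_{0,1}P_{1,2}\cdots P_{n-1,n}}$ and $\pi_{II}=\mathrm{diag}(\pi_{II,0},\pi_{II,1},\dots)$, $T$ is defined by $P_{II}=\pi_{II}T\pi_{II}^{-1}$; in the type I case, with $\pi_{I,0}=1$, $\pi_{I,n}=\frac1{P_{1,0}P_{2,1}\cdots P_{n,n-1}}$ and $\pi_I=\mathrm{diag}(\pi_{I,0},\pi_{I,1},\dots)$, $T$ is defined by $P_I=\pi_I^{-1}T^\top\pi_I$. Then $T_{n,n+1}=1$, $T_{i,j}=0$ if $j>i+1$ or $j<i-p$, $T_{n,n-p}\ne0$ for $n\ge p$, and $T=L_1\cdots L_pU$ with $L_k$ lower bidiagonal with unit diagonal, $(L_k)_{j+1,j}=\alpha_{k+1+j(p+1)}$, $U$ upper bidiagonal with unit superdiagonal, $U_{j,j}=\alpha_{1+j(p+1)}$, all $\alpha_i>0$. Type II recursion polynomials: $B_0=1$, $B_{n+1}=(x-T_{n,n})B_n-T_{n,n-1}B_{n-1}-\cdots-T_{n,n-p}B_{n-p}$ (terms with negative index are $0$). Type I recursion polynomials: given a real lower unitriangular $p\times p$ matrix $\nu$ (initial condition matrix), $A^{(a)}_{j}=\nu_{j+1,a}$ for $0\le j\le p-1$, $A^{(a)}_{-1}=0$, and $A^{(a)}_{n-1}+T_{n,n}A^{(a)}_n+\cdots+T_{n+p,n}A^{(a)}_{n+p}=xA^{(a)}_n$, $n\in\mathbb N_0$, $a\in\{1,\dots,p\}$. The matrix $\nu$ is chosen such that $(\nu^{-1})^{\top}=\mathscr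 L\mathscr C$ with $\mathscr C\in\mathbb R^{p\times p}$ entrywise nonnegative upper unitriangular and $\mathscr L=[\mathscr L_1\cdots\mathscr L_p]$, $\mathscr L_1=(1,0,\dots,0)^\top$, $\mathscr L_k=\frac1{d_k}L_1^{[p-1]}\cdots L_{k-1}^{[p-1]}(1,0,\dots,0)^\top$, $d_k=\alpha_k\alpha_{k+p}\cdots\alpha_{k+(k-2)p}$ for $2\le k\le p$ ($L_i^{[p-1]}$ is the leading $p\times p$ principal submatrix of $L_i$). For such $\nu$ there are positive Lebesgue--Stieltjes measures $\mathrm d\psi_1,\dots,\mathrm d\psi_p$ supported in $[0,1]$ with $\int_0^1\sum_{a=1}^pA_k^{(a)}(x)B_l(x)\,\mathrm d\psi_a(x)=\delta_{k,l}$, $k,l\in\mathbb N_0$; these are the associated measures. $m_a$ denotes the mass of $\mathrm d\psi_a$ at the point $1$. The component $\pi_{n+1}$ corresponds to the state $n$. *)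

theory Defs
  imports
    "HOL-Probability.Probability"
    "HOL-Computational_Algebra.Polynomial"
    "Jordan_Normal_Form.Matrix"
begin

text \<open>
  Semi-infinite real matrices are functions \<open>nat \<Rightarrow> nat \<Rightarrow> real\<close> with rows and columns numbered
  from 0. Every product formed below has row-finite factors, so the series defining an entry of
  a product has only finitely many nonzero terms.
\<close>

type_synonym inf_mat = "nat \<Rightarrow> nat \<Rightarrow> real"

definition inf_mat_mult :: "inf_mat \<Rightarrow> inf_mat \<Rightarrow> inf_mat" where
  "inf_mat_mult A B = (\<lambda>i j. \<Sum>k. A i k * B k j)"

definition inf_mat_one :: inf_mat where
  "inf_mat_one = (\<lambda>i j. of_bool (i = j))"

definition inf_mat_prod :: "inf_mat list \<Rightarrow> inf_mat" where
  "inf_mat_prod As = foldr inf_mat_mult As inf_mat_one"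

definition stochastic_matrix :: "inf_mat \<Rightarrow> bool" where
  "stochastic_matrix P \<longleftrightarrow> (\<forall>i j. 0 \<le> P i j) \<and> (\<forall>i. P i sums 1)"

text \<open>\<open>j + p < i\<close> expresses \<open>j < i - p\<close> without truncated subtraction.\<close>

definition type_II_banded_stochastic :: "nat \<Rightarrow> inf_mat \<Rightarrow> bool" where
  "type_II_banded_stochastic p P \<longleftrightarrow> stochastic_matrix P \<and>
     (\<forall>i j. j > i + 1 \<or> j + p < i \<longrightarrow> P i j = 0)"

definition type_I_banded_stochastic :: "nat \<Rightarrow> inf_mat \<Rightarrow> bool" where
  "type_I_banded_stochastic p P \<longleftrightarrow> stochastic_matrix P \<and>
     (\<forall>i j. j > i + p \<or> j + 1 < i \<longrightarrow> P i j = 0)"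

definition lower_bidiagonal_stochastic :: "inf_mat \<Rightarrow> bool" where
  "lower_bidiagonal_stochastic L \<longleftrightarrow>
     (\<forall>i j. i \<noteq> j \<and> i \<noteq> Suc j \<longrightarrow> L i j = 0) \<and> L 0 0 = 1 \<and>
     (\<forall>k. L (Suc k) k + L (Suc k) (Suc k) = 1 \<and> L (Suc k) k > 0 \<and> L (Suc k) (Suc k) > 0)"

definition upper_bidiagonal_stochastic :: "inf_mat \<Rightarrow> bool" where
  "upper_bidiagonal_stochastic U \<longleftrightarrow>
     (\<forall>i j. j \<noteq> i \<and> j \<noteq> Suc i \<longrightarrow> U i j = 0) \<and>
     (\<forall>k. U k k + U k (Suc k) = 1 \<and> U k k > 0 \<and> U k (Suc k) > 0)"

definition psbf_type_II :: "nat \<Rightarrow> inf_mat \<Rightarrow> bool" where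
  "psbf_type_II p P \<longleftrightarrow> (\<exists>L U.
     (\<forall>a\<in>{1..p}. lower_bidiagonal_stochastic (L a)) \<and> upper_bidiagonal_stochastic U \<and>
     P = inf_mat_prod (map L [1..<Suc p] @ [U]))"

definition psbf_type_I :: "nat \<Rightarrow> inf_mat \<Rightarrow> bool" where
  "psbf_type_I p P \<longleftrightarrow> (\<exists>L U.
     lower_bidiagonal_stochastic L \<and> (\<forall>a\<in>{1..p}. upper_bidiagonal_stochastic (U a)) \<and>
     P = inf_mat_prod (L # map U (rev [1..<Suc p])))"

definition pi_II :: "inf_mat \<Rightarrow> nat \<Rightarrow> real" where
  "pi_II P n = 1 / (\<Prod>k<n. P k (Suc k))"

definition pi_I :: "inf_mat \<Rightarrow> nat \<Rightarrow> real" where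
  "pi_I P n = 1 / (\<Prod>k<n. P (Suc k) k)"

text \<open>
  \<open>P = \<pi> T \<pi>\<inverse>\<close>, respectively \<open>P = \<pi>\<inverse> T\<^sup>\<top> \<pi>\<close>, with \<open>\<pi>\<close> the diagonal matrix with diagonal
  \<open>pi_II P\<close>, respectively \<open>pi_I P\<close>, written out entrywise.
\<close>

definition hessenberg_of_type_II :: "inf_mat \<Rightarrow> inf_mat \<Rightarrow> bool" where
  "hessenberg_of_type_II P T \<longleftrightarrow> (\<forall>i j. P i j = pi_II P i * T i j / pi_II P j)"

definition hessenberg_of_type_I :: "inf_mat \<Rightarrow> inf_mat \<Rightarrow> bool" where
  "hessenberg_of_type_I P T \<longleftrightarrow> (\<forall>i j. P i j = T j i * pi_I P j / pi_I P i)"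

definition pbf_lower :: "nat \<Rightarrow> (nat \<Rightarrow> real) \<Rightarrow> nat \<Rightarrow> inf_mat" where
  "pbf_lower p \<alpha> k = (\<lambda>i j. if i = j then 1
     else if i = Suc j then \<alpha> (k + 1 + j * (p + 1)) else 0)"

definition pbf_upper :: "nat \<Rightarrow> (nat \<Rightarrow> real) \<Rightarrow> inf_mat" where
  "pbf_upper p \<alpha> = (\<lambda>i j. if i = j then \<alpha> (1 + j * (p + 1))
     else if j = Suc i then 1 else 0)"

definition positive_bidiagonal_factorization :: "nat \<Rightarrow> inf_mat \<Rightarrow> (nat \<Rightarrow> real) \<Rightarrow> bool" where
  "positive_bidiagonal_factorization p T \<alpha> \<longleftrightarrow> (\<forall>i\<ge>1. \<alpha> i > 0) \<and>
     T = inf_mat_prod (map (pbf_lower p \<alpha>) [1..<Suc p] @ [pbf_upper p \<alpha>])"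

text \<open>
  In the type II recursion the index set \<open>{n - p..<n}\<close> (truncated subtraction) consists of
  the nonnegative ones among \<open>n - p, \<dots>, n - 1\<close>, so that terms of negative index are absent.
\<close>

definition type_II_polynomials :: "nat \<Rightarrow> inf_mat \<Rightarrow> (nat \<Rightarrow> real poly) \<Rightarrow> bool" where
  "type_II_polynomials p T B \<longleftrightarrow> B 0 = 1 \<and>
     (\<forall>n. B (Suc n) = [:- T n n, 1:] * B n - (\<Sum>j\<in>{n - p..<n}. Polynomial.smult (T n j) (B j)))"

text \<open>
  \<open>A a n\<close> is the \<open>n\<close>-th polynomial of the family with superscript \<open>a \<in> {1..p}\<close>. Finite matrices
  are 0-based, so the entry of \<open>\<nu>\<close> in row \<open>j + 1\<close> and column \<open>a\<close> is \<open>\<nu> $$ (j, a - 1)\<close>.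
\<close>

definition type_I_polynomials ::
  "nat \<Rightarrow> inf_mat \<Rightarrow> real mat \<Rightarrow> (nat \<Rightarrow> nat \<Rightarrow> real poly) \<Rightarrow> bool" where
  "type_I_polynomials p T \<nu> A \<longleftrightarrow> (\<forall>a\<in>{1..p}.
     (\<forall>j<p. A a j = [:\<nu> $$ (j, a - 1):]) \<and>
     (\<forall>n. (if n = 0 then 0 else A a (n - 1)) + (\<Sum>k\<le>p. Polynomial.smult (T (n + k) n) (A a (n + k)))
            = [:0, 1:] * A a n))"

definition upper_unitriangular :: "nat \<Rightarrow> real mat \<Rightarrow> bool" where
  "upper_unitriangular p M \<longleftrightarrow> M \<in> carrier_mat p p \<and> upper_triangular M \<and> (\<forall>i<p. M $$ (i, i) = 1)"

definition lower_unitriangular :: "nat \<Rightarrow> real mat \<Rightarrow> bool" where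
  "lower_unitriangular p M \<longleftrightarrow> upper_unitriangular p (transpose_mat M)"

definition leading_submatrix :: "nat \<Rightarrow> inf_mat \<Rightarrow> real mat" where
  "leading_submatrix p L = mat p p (\<lambda>(i, j). L i j)"

text \<open>
  The column with index \<open>k = 1\<close> is covered by the general formula: the product of matrices and
  the scalar \<open>d\<^sub>1\<close> are then empty products.
\<close>

definition script_L_scalar :: "nat \<Rightarrow> (nat \<Rightarrow> real) \<Rightarrow> nat \<Rightarrow> real" where
  "script_L_scalar p \<alpha> k = (\<Prod>j<k - 1. \<alpha> (k + j * p))"

definition script_L_column :: "nat \<Rightarrow> (nat \<Rightarrow> real) \<Rightarrow> nat \<Rightarrow> real vec" where
  "script_L_column p \<alpha> k = (1 / script_L_scalar p \<alpha> k) \<cdot>\<^sub>v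
     foldr (\<lambda>i v. leading_submatrix p (pbf_lower p \<alpha> i) *\<^sub>v v) [1..<k] (unit_vec p 0)"

definition script_L :: "nat \<Rightarrow> (nat \<Rightarrow> real) \<Rightarrow> real mat" where
  "script_L p \<alpha> = mat_of_cols p (map (script_L_column p \<alpha>) [1..<Suc p])"

definition admissible_initial_matrix :: "nat \<Rightarrow> (nat \<Rightarrow> real) \<Rightarrow> real mat \<Rightarrow> bool" where
  "admissible_initial_matrix p \<alpha> \<nu> \<longleftrightarrow> lower_unitriangular p \<nu> \<and>
     (\<exists>N C. N \<in> carrier_mat p p \<and> inverts_mat \<nu> N \<and> inverts_mat N \<nu> \<and>
        upper_unitriangular p C \<and> (\<forall>i<p. \<forall>j<p. C $$ (i, j) \<ge> 0) \<and>
        transpose_mat N = script_L p \<alpha> * C)"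

text \<open>
  Positive Lebesgue--Stieltjes measures supported in the unit interval are finite Borel measures
  on the real line for which the complement of the interval is a null set.
\<close>

definition unit_interval_measure :: "real measure \<Rightarrow> bool" where
  "unit_interval_measure \<mu> \<longleftrightarrow> sets \<mu> = sets borel \<and> finite_measure \<mu> \<and> emeasure \<mu> (- {0..1}) = 0"

definition associated_measures ::
  "nat \<Rightarrow> (nat \<Rightarrow> nat \<Rightarrow> real poly) \<Rightarrow> (nat \<Rightarrow> real poly) \<Rightarrow> (nat \<Rightarrow> real measure) \<Rightarrow> bool" where
  "associated_measures p A B \<psi> \<longleftrightarrow> (\<forall>a\<in>{1..p}. unit_interval_measure (\<psi> a)) \<and>
     (\<forall>k l. (\<Sum>a\<in>{1..p}. LINT x:{0..1}|\<psi> a. poly (A a k) x * poly (B l) x) = of_bool (k = l))"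

text \<open>
  \<open>walk P n i\<close> is the law of \<open>[X\<^sub>0, \<dots>, X\<^sub>n]\<close> for the Markov chain \<open>X\<close> with (stochastic) transition
  matrix \<open>P\<close> started in the state \<open>i\<close>. For \<open>n \<ge> 1\<close>, \<open>first_return P i n\<close> is the probability that
  its first return to \<open>i\<close> happens at time \<open>n\<close>.
\<close>

primrec walk :: "inf_mat \<Rightarrow> nat \<Rightarrow> nat \<Rightarrow> nat list pmf" where
  "walk P 0 i = return_pmf [i]"
| "walk P (Suc n) i = bind_pmf (embed_pmf (P i)) (\<lambda>j. map_pmf ((#) i) (walk P n j))"

definition first_return :: "inf_mat \<Rightarrow> nat \<Rightarrow> nat \<Rightarrow> real" where
  "first_return P i n =
     measure_pmf.prob (walk P n i) {w. w ! n = i \<and> (\<forall>k. 0 < k \<and> k < n \<longrightarrow> w ! k \<noteq> i)}"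

definition positive_recurrent_state :: "inf_mat \<Rightarrow> nat \<Rightarrow> bool" where
  "positive_recurrent_state P i \<longleftrightarrow>
     (\<lambda>n. first_return P i (Suc n)) sums 1 \<and>
     summable (\<lambda>n. real (Suc n) * first_return P i (Suc n))"

text \<open>
  The chains considered here are irreducible and have positive diagonal transition
  probabilities, hence are aperiodic; ergodicity is therefore positive recurrence.
\<close>

definition ergodic_chain :: "inf_mat \<Rightarrow> bool" where
  "ergodic_chain P \<longleftrightarrow> (\<forall>i. positive_recurrent_state P i)"

definition stationary_distribution :: "inf_mat \<Rightarrow> (nat \<Rightarrow> real) \<Rightarrow> bool" where
  "stationary_distribution P q \<longleftrightarrow> (\<forall>i. 0 \<le> q i) \<and> q sums 1 \<and>
     (\<forall>j. (\<lambda>i. q i * P i j) sums q j)"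

end

theory Submission
  imports Defs
begin

text \<open>
  The type I and type II polynomials are formal left and right eigenvectors of \<open>T\<close> with eigenvalue
  \<open>x\<close>, and they are biorthogonal with respect to the measures. Hence the mixed moments
  \<open>\<Sum>\<^sub>a \<integral> x\<^sup>n A\<^sub>j\<^sup>(\<^sup>a\<^sup>) B\<^sub>i d\<psi>\<^sub>a\<close> satisfy the recursion of the matrix powers and equal \<open>(T\<^sup>n)\<^sub>i\<^sub>j\<close>, on either
  side (\<open>mixed_moment_Suc_left\<close>, \<open>mixed_moment_Suc_right\<close>). As \<open>x\<^sup>n\<close> decreases on the unit interval
  to the indicator of the point 1, dominated convergence shows that the moments converge to
  \<open>B\<^sub>i(1) Q\<^sub>j\<close>, where \<open>Q\<^sub>j = \<Sum>\<^sub>a A\<^sub>j\<^sup>(\<^sup>a\<^sup>)(1) m\<^sub>a\<close>. The chain has transition matrix \<open>T\<close>, or its transpose,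
  up to conjugation by a diagonal matrix, so its transition probabilities converge to a matrix
  of rank one, \<open>(P\<^sup>n)\<^sub>i\<^sub>j \<longlonglongrightarrow> h\<^sub>i w\<^sub>j\<close>, with diagonal entries \<open>h\<^sub>j w\<^sub>j = Q\<^sub>j B\<^sub>j(1)\<close>. The entry at
  \<open>(0, 0)\<close> is \<open>m\<^sub>1\<close>, because \<open>\<nu>\<close> is lower unitriangular and \<open>B\<^sub>0 = 1\<close>.

  The rest is the theory of Markov chains, in the simple form that it takes when these limits
  are known to exist. By the renewal equation the limiting return probability of a state is the
  inverse of its mean return time, so the state is positive recurrent exactly when the
  limit is positive (\<open>renewal_limit_pos_iff\<close>). The bidiagonal factors make all entries next to
  the diagonal of \<open>P\<close> positive, so that the chain is irreducible and one state decides for all.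

  It remains to see in the ergodic case that \<open>h\<close> is constant and that the diagonal of the
  limit is the only stationary distribution. The rows of the limit matrix are invariant,
  and its row sums are at most 1. Invariance makes the limit matrix idempotent, which forces all
  row sums to be equal to 1 (\<open>rank_one_limit\<close>).
\<close>

section \<open>Powers of row-finite matrices\<close>

definition mat_power :: "inf_mat \<Rightarrow> nat \<Rightarrow> inf_mat" where
  "mat_power M n = (inf_mat_mult M ^^ n) inf_mat_one"

lemma mat_power_0 [simp]: "mat_power M 0 i j = of_bool (i = j)"
  by (simp add: mat_power_def inf_mat_one_def)

lemma mat_power_Suc:
  assumes "finite S" and "\<And>k. k \<notin> S \<Longrightarrow> M i k = 0"
  shows "mat_power M (Suc n) i j = (\<Sum>k\<in>S. M i k * mat_power M n k j)"
proof -
  have "mat_power M (Suc n) i j = (\<Sum>k. M i k * mat_power M n k j)"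
    by (simp add: mat_power_def inf_mat_mult_def)
  also have "\<dots> = (\<Sum>k\<in>S. M i k * mat_power M n k j)"
    using assms by (intro suminf_finite) auto
  finally show ?thesis .
qed

lemma mat_power_nonneg:
  assumes "\<And>i j. 0 \<le> M i j" and "\<And>i. finite {k. M i k \<noteq> 0}"
  shows "0 \<le> mat_power M n i j"
proof (induction n arbitrary: i)
  case (Suc n)
  have "mat_power M (Suc n) i j = (\<Sum>k | M i k \<noteq> 0. M i k * mat_power M n k j)"
    by (rule mat_power_Suc) (auto simp: assms(2))
  then show ?case using assms(1) Suc by (simp add: sum_nonneg)
qed simp

text \<open>
  The powers of \<open>R\<close> enter only through their recursion, so that moments can be put in their place.
\<close>

lemma mat_power_conjugate:
  fixes P R :: inf_mat and M :: "nat \<Rightarrow> inf_mat"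
  assumes conj: "\<And>i j. P i j = d i * R i j / d j" and d: "\<And>i. d i \<noteq> 0"
    and fin: "\<And>i. finite (S i)" and supp: "\<And>i k. k \<notin> S i \<Longrightarrow> R i k = 0"
    and M0: "\<And>i j. M 0 i j = of_bool (i = j)"
    and MSuc: "\<And>n i j. M (Suc n) i j = (\<Sum>k\<in>S i. R i k * M n k j)"
  shows "mat_power P n i j = d i * M n i j / d j"
proof (induction n arbitrary: i)
  case 0
  then show ?case using d by (simp add: M0)
next
  case (Suc n)
  have "mat_power P (Suc n) i j = (\<Sum>k\<in>S i. P i k * mat_power P n k j)"
    using fin supp conj by (intro mat_power_Suc) auto
  also have "\<dots> = (\<Sum>k\<in>S i. d i * (R i k * M n k j) / d j)"
    using d by (intro sum.cong) (auto simp: Suc conj)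
  also have "\<dots> = d i * M (Suc n) i j / d j"
    by (simp add: MSuc sum_distrib_left sum_divide_distrib)
  finally show ?case .
qed

section \<open>The renewal equation\<close>

text \<open>
  For a recurrent event with return probabilities \<open>u\<close> and first return probabilities \<open>f\<close>, the sum
  is over the time \<open>n - k\<close> of the last visit up to time \<open>n\<close>, after which there is no return for
  \<open>k\<close> steps. Here \<open>f k\<close> belongs to a first return at time \<open>k + 1\<close>.
\<close>

lemma renewal_tail_identity:
  fixes f u :: "nat \<Rightarrow> real"
  assumes u0: "u 0 = 1" and renewal: "\<And>n. u (Suc n) = (\<Sum>k\<le>n. f k * u (n - k))"
  shows "(\<Sum>k\<le>n. (1 - (\<Sum>m<k. f m)) * u (n - k)) = 1"
proof (induction n)
  case 0
  then show ?case by (simp add: u0)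
next
  case (Suc n)
  have "(\<Sum>k\<le>Suc n. (1 - (\<Sum>m<k. f m)) * u (Suc n - k))
      = u (Suc n) + (\<Sum>k\<le>n. (1 - (\<Sum>m<Suc k. f m)) * u (n - k))"
    by (subst sum.atMost_Suc_shift) simp
  also have "(\<Sum>k\<le>n. (1 - (\<Sum>m<Suc k. f m)) * u (n - k))
      = (\<Sum>k\<le>n. (1 - (\<Sum>m<k. f m)) * u (n - k)) - (\<Sum>k\<le>n. f k * u (n - k))"
    by (simp add: sum_subtractf[symmetric] algebra_simps)
  finally show ?case by (simp add: Suc renewal)
qed

text \<open>
  Summation by parts: it compares the series of the tails, which occurs in the renewal identity,
  with the mean return time.
\<close>

lemma sum_tails_eq:
  fixes f :: "nat \<Rightarrow> real"
  shows "(\<Sum>k\<le>N. 1 - (\<Sum>m<k. f m))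
    = (\<Sum>k<N. real (Suc k) * f k) + real (Suc N) * (1 - (\<Sum>m<N. f m))"
  by (induction N) (auto simp: algebra_simps)

lemma summable_tails_iff:
  fixes f :: "nat \<Rightarrow> real"
  assumes f: "\<And>n. 0 \<le> f n" and le1: "\<And>n. (\<Sum>k<n. f k) \<le> 1"
  shows "summable (\<lambda>k. 1 - (\<Sum>m<k. f m)) \<longleftrightarrow>
    f sums 1 \<and> summable (\<lambda>n. real (Suc n) * f n)" (is "summable ?r \<longleftrightarrow> ?R")
proof
  assume r: "summable ?r"
  have r0: "0 \<le> ?r k" for k using le1 by simp
  have "(\<lambda>k. 1 - ?r k) \<longlonglongrightarrow> 1 - 0"
    by (intro tendsto_intros summable_LIMSEQ_zero r)
  then have "f sums 1" by (simp add: sums_def)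
  moreover have "summable (\<lambda>n. real (Suc n) * f n)"
  proof (rule bounded_imp_summable)
    show "0 \<le> real (Suc n) * f n" for n using f by simp
    show "(\<Sum>k\<le>n. real (Suc k) * f k) \<le> suminf ?r" for n
    proof -
      have "(\<Sum>k\<le>n. real (Suc k) * f k) \<le> (\<Sum>k\<le>Suc n. ?r k)"
        using r0[of "Suc n"] unfolding sum_tails_eq lessThan_Suc_atMost by simp
      also have "\<dots> \<le> suminf ?r"
        by (intro sum_le_suminf r) (use r0 in auto)
      finally show ?thesis .
    qed
  qed
  ultimately show ?R by blast
next
  assume R: ?R
  then have f1: "f sums 1" and m: "summable (\<lambda>n. real (Suc n) * f n)" by auto
  have r0: "0 \<le> ?r k" for k using le1 by simp
  \<comment> \<open>The boundary term of the summation by parts is at most the tail of the mean.\<close>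
  have tail: "real (Suc n) * ?r n \<le> (\<Sum>k. real (Suc (k + n)) * f (k + n))" for n
  proof -
    have "?r n = (\<Sum>k. f (k + n))"
      using f1 suminf_minus_initial_segment[of f n] by (auto simp: sums_iff)
    also have "real (Suc n) * \<dots> = (\<Sum>k. real (Suc n) * f (k + n))"
      using f1 by (subst suminf_mult) (auto simp: sums_iff summable_iff_shift)
    also have "\<dots> \<le> (\<Sum>k. real (Suc (k + n)) * f (k + n))"
    proof (rule suminf_le)
      show "real (Suc n) * f (k + n) \<le> real (Suc (k + n)) * f (k + n)" for k
        using f by (intro mult_right_mono) auto
      show "summable (\<lambda>k. real (Suc n) * f (k + n))"
        using f1 by (intro summable_mult) (auto simp: sums_iff summable_iff_shift)
      show "summable (\<lambda>k. real (Suc (k + n)) * f (k + n))"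
        using summable_iff_shift[of "\<lambda>n. real (Suc n) * f n" n] m by simp
    qed
    finally show ?thesis .
  qed
  show "summable ?r"
  proof (rule bounded_imp_summable)
    show "0 \<le> ?r k" for k by (rule r0)
    show "(\<Sum>k\<le>n. ?r k) \<le> (\<Sum>k. real (Suc k) * f k)" for n
      using tail[of n] suminf_split_initial_segment[OF m, of n]
      unfolding sum_tails_eq by simp
  qed
qed

text \<open>
  Let \<open>n\<close> tend to infinity in the identity \<open>\<Sum>\<^sub>k r\<^sub>k u\<^sub>n\<^sub>-\<^sub>k = 1\<close>, where \<open>r\<close> denotes the tails of \<open>f\<close>. If the
  tails are summable, dominated convergence gives \<open>L \<Sum>\<^sub>k r\<^sub>k = 1\<close>; if \<open>L > 0\<close>, truncating the sum
  bounds the partial sums of the tails by \<open>1 / L\<close>. This is the renewal theorem without its hard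
  part, the existence of the limit.
\<close>

lemma renewal_limit_pos_iff:
  fixes f u :: "nat \<Rightarrow> real"
  assumes f: "\<And>n. 0 \<le> f n" and le1: "\<And>n. (\<Sum>k<n. f k) \<le> 1"
    and u: "\<And>n. 0 \<le> u n" "\<And>n. u n \<le> 1" and u0: "u 0 = 1"
    and renewal: "\<And>n. u (Suc n) = (\<Sum>k\<le>n. f k * u (n - k))"
    and lim: "u \<longlonglongrightarrow> L"
  shows "f sums 1 \<and> summable (\<lambda>n. real (Suc n) * f n) \<longleftrightarrow> L > 0"
proof -
  define r where "r k = 1 - (\<Sum>m<k. f m)" for k
  have r0: "0 \<le> r k" for k using le1 by (simp add: r_def)
  have id: "(\<Sum>k\<le>n. r k * u (n - k)) = 1" for n
    unfolding r_def using renewal_tail_identity[OF u0 renewal] .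
  have shift: "(\<lambda>n. u (n - k)) \<longlonglongrightarrow> L" for k
    by (rule LIMSEQ_offset[where k = k]) (simp add: lim)
  have "summable r \<longleftrightarrow> L > 0"
  proof
    assume r: "summable r"
    let ?a = "\<lambda>k n. if k \<le> n then r k * u (n - k) else 0"
    have "(\<lambda>n. \<Sum>k. ?a k n) \<longlonglongrightarrow> (\<Sum>k. r k * L)"
    proof (rule tannerys_theorem[THEN conjunct2, THEN conjunct2])
      show "(?a k) \<longlonglongrightarrow> r k * L" for k
      proof (rule Lim_transform_eventually)
        show "(\<lambda>n. r k * u (n - k)) \<longlonglongrightarrow> r k * L"
          by (intro tendsto_intros shift)
        show "eventually (\<lambda>n. r k * u (n - k) = ?a k n) sequentially"
          using eventually_ge_at_top[of k] by eventually_elim simp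
      qed
      show "eventually (\<lambda>(k, n). norm (?a k n) \<le> r k) (sequentially \<times>\<^sub>F sequentially)"
        using r0 u by (intro always_eventually) (auto intro: mult_left_le)
    qed (use r in auto)
    moreover have "(\<Sum>k. ?a k n) = 1" for n
    proof -
      have "(\<Sum>k. ?a k n) = (\<Sum>k\<le>n. ?a k n)" by (intro suminf_finite) auto
      also have "\<dots> = (\<Sum>k\<le>n. r k * u (n - k))" by (intro sum.cong) auto
      finally show ?thesis by (simp only: id)
    qed
    ultimately have "(\<Sum>k. r k * L) = 1" by (simp add: LIMSEQ_const_iff)
    then have "L \<noteq> 0" by auto
    moreover have "0 \<le> L" using LIMSEQ_le_const[OF lim, of 0] u(1) by auto
    ultimately show "L > 0" by simp
  next
    assume L: "L > 0"
    show "summable r"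
    proof (rule bounded_imp_summable)
      show "0 \<le> r k" for k by (rule r0)
      show "(\<Sum>k\<le>N. r k) \<le> 1 / L" for N
      proof -
        have "(\<Sum>k\<le>N. r k * L) \<le> 1"
        proof (rule LIMSEQ_le_const2)
          show "(\<lambda>n. \<Sum>k\<le>N. r k * u (n - k)) \<longlonglongrightarrow> (\<Sum>k\<le>N. r k * L)"
            by (intro tendsto_intros shift)
          have "(\<Sum>k\<le>N. r k * u (n - k)) \<le> 1" if "n \<ge> N" for n
          proof -
            have "(\<Sum>k\<le>N. r k * u (n - k)) \<le> (\<Sum>k\<le>n. r k * u (n - k))"
              using that r0 u by (intro sum_mono2) auto
            then show ?thesis by (simp add: id)
          qed
          then show "\<exists>N'. \<forall>n\<ge>N'. (\<Sum>k\<le>N. r k * u (n - k)) \<le> 1" by blast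
        qed
        then show ?thesis using L by (simp add: sum_distrib_right[of r, symmetric] pos_le_divide_eq)
      qed
    qed
  qed
  then show ?thesis
    using summable_tails_iff[OF f le1] by (simp add: r_def[abs_def])
qed

section \<open>Irreducible chains with finite rows and columns\<close>

lemma measure_bind_pmf_finite:
  assumes "finite S" and "set_pmf M \<subseteq> S"
  shows "measure_pmf.prob (bind_pmf M f) X = (\<Sum>k\<in>S. pmf M k * measure_pmf.prob (f k) X)"
proof -
  have "emeasure (measure_pmf (bind_pmf M f)) X = (\<Sum>k\<in>S. emeasure (measure_pmf (f k)) X * ennreal (pmf M k))"
    unfolding emeasure_bind_pmf using assms
    by (intro nn_integral_measure_pmf_support) auto
  also have "\<dots> = ennreal (\<Sum>k\<in>S. pmf M k * measure_pmf.prob (f k) X)"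
    by (subst sum_ennreal[symmetric])
      (auto simp: measure_pmf.emeasure_eq_measure ennreal_mult' mult.commute intro!: sum.cong)
  finally show ?thesis
    by (simp add: measure_pmf.emeasure_eq_measure sum_nonneg)
qed

text \<open>
  Finite rows and columns turn every step on the level of matrix entries into a finite sum; in
  particular limits of matrix powers may be multiplied by \<open>P\<close> on the right, where in
  general Fatou's lemma gives only an inequality.
\<close>

locale irreducible_chain =
  fixes P :: inf_mat
  assumes stochastic: "stochastic_matrix P"
    and finite_row: "finite {k. P i k \<noteq> 0}"
    and finite_column: "finite {i. P i j \<noteq> 0}"
    and irreducible: "\<exists>n. 0 < mat_power P n i j"
begin

definition row_support :: "nat \<Rightarrow> nat set" where "row_support i = {k. P i k \<noteq> 0}"

lemma finite_row_support [simp]: "finite (row_support i)"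
  by (simp add: row_support_def finite_row)

lemma nonneg: "0 \<le> P i j"
  using stochastic by (simp add: stochastic_matrix_def)

lemma row_sum: "(\<Sum>k\<in>row_support i. P i k) = 1"
proof -
  have "P i sums 1" using stochastic by (simp add: stochastic_matrix_def)
  moreover have "P i sums (\<Sum>k\<in>row_support i. P i k)"
    by (intro sums_finite) (auto simp: row_support_def finite_row)
  ultimately show ?thesis using sums_unique2 by blast
qed

lemma power_Suc: "mat_power P (Suc n) i j = (\<Sum>k\<in>row_support i. P i k * mat_power P n k j)"
  by (rule mat_power_Suc) (auto simp: row_support_def finite_row)

lemma power_nonneg: "0 \<le> mat_power P n i j"
  by (rule mat_power_nonneg[OF nonneg finite_row])

lemma row_average_le:
  assumes "\<And>k. g k \<le> c"
  shows "(\<Sum>k\<in>row_support i. P i k * g k) \<le> c"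
proof -
  have "(\<Sum>k\<in>row_support i. P i k * g k) \<le> (\<Sum>k\<in>row_support i. P i k * c)"
    using assms nonneg by (intro sum_mono mult_left_mono)
  also have "\<dots> = c" by (simp add: sum_distrib_right[symmetric] row_sum)
  finally show ?thesis .
qed

lemma power_row_sum_le: "finite F \<Longrightarrow> (\<Sum>j\<in>F. mat_power P n i j) \<le> 1"
proof (induction n arbitrary: i)
  case 0
  then show ?case using card_mono[of "{i}" "F \<inter> {i}"] by simp
next
  case (Suc n)
  have "(\<Sum>j\<in>F. mat_power P (Suc n) i j)
      = (\<Sum>k\<in>row_support i. P i k * (\<Sum>j\<in>F. mat_power P n k j))"
    by (simp add: power_Suc sum_distrib_left) (rule sum.swap)
  then show ?case using row_average_le[OF Suc.IH] Suc.prems by simp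
qed

lemma power_le_1: "mat_power P n i j \<le> 1"
  using power_row_sum_le[of "{j}"] by simp

lemma power_add_ge: "mat_power P m i k * mat_power P n k j \<le> mat_power P (m + n) i j"
proof (induction m arbitrary: i)
  case 0
  then show ?case by (simp add: power_nonneg)
next
  case (Suc m)
  have "mat_power P (Suc m) i k * mat_power P n k j
      = (\<Sum>l\<in>row_support i. P i l * (mat_power P m l k * mat_power P n k j))"
    by (simp add: power_Suc sum_distrib_right mult.assoc)
  also have "\<dots> \<le> (\<Sum>l\<in>row_support i. P i l * mat_power P (m + n) l j)"
    by (intro sum_mono mult_left_mono Suc nonneg)
  finally show ?case by (simp add: power_Suc)
qed

lemma finite_power_column: "finite {i. mat_power P n i j \<noteq> 0}"
proof (induction n)
  case 0
  then show ?case by simp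
next
  case (Suc n)
  have "{i. mat_power P (Suc n) i j \<noteq> 0} \<subseteq> (\<Union>k\<in>{k. mat_power P n k j \<noteq> 0}. {i. P i k \<noteq> 0})"
  proof
    fix i assume "i \<in> {i. mat_power P (Suc n) i j \<noteq> 0}"
    then have "(\<Sum>k\<in>row_support i. P i k * mat_power P n k j) \<noteq> 0"
      by (simp add: power_Suc)
    then obtain k where "P i k * mat_power P n k j \<noteq> 0"
      by (rule sum.not_neutral_contains_not_neutral)
    then show "i \<in> (\<Union>k\<in>{k. mat_power P n k j \<noteq> 0}. {i. P i k \<noteq> 0})" by auto
  qed
  then show ?case
    by (rule finite_subset) (use Suc finite_column in blast)
qed

lemma prob_walk_Suc:
  "measure_pmf.prob (walk P (Suc n) i) X
    = (\<Sum>k\<in>row_support i. P i k * measure_pmf.prob (walk P n k) ((#) i -` X))"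
proof -
  have "P i sums 1" using stochastic by (simp add: stochastic_matrix_def)
  then have "(\<Sum>k. ennreal (P i k)) = 1"
    by (subst suminf_ennreal2) (auto simp: nonneg sums_iff)
  then have "(\<integral>\<^sup>+k. ennreal (P i k) \<partial>count_space UNIV) = 1"
    by (simp add: nn_integral_count_space_nat)
  then have pmf: "pmf (embed_pmf (P i)) k = P i k" for k
    by (intro pmf_embed_pmf nonneg)
  have "set_pmf (embed_pmf (P i)) \<subseteq> row_support i"
    by (auto simp: set_pmf_eq pmf row_support_def)
  then show ?thesis
    by (simp add: measure_bind_pmf_finite[OF finite_row_support] pmf)
qed

text \<open>
  Time 0 counts here, in contrast to the first return: a walk that starts in \<open>i\<close> has hit \<open>i\<close>
  immediately. With this convention the first return decomposes into one step
  followed by a first hit.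
\<close>

definition first_hit :: "nat \<Rightarrow> nat \<Rightarrow> nat \<Rightarrow> real" where
  "first_hit i n j = measure_pmf.prob (walk P n j) {w. w ! n = i \<and> (\<forall>k<n. w ! k \<noteq> i)}"

lemma first_hit_0: "first_hit i 0 j = of_bool (j = i)"
  by (auto simp: first_hit_def indicator_def)

lemma first_hit_Suc:
  "first_hit i (Suc n) j = (if j = i then 0 else \<Sum>k\<in>row_support j. P j k * first_hit i n k)"
proof -
  have "(#) j -` {w. w ! Suc n = i \<and> (\<forall>k<Suc n. w ! k \<noteq> i)}
      = (if j = i then {} else {w. w ! n = i \<and> (\<forall>k<n. w ! k \<noteq> i)})"
    by (auto simp: All_less_Suc2)
  then show ?thesis unfolding first_hit_def prob_walk_Suc by simp
qed

lemma first_return_Suc: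
  "first_return P i (Suc n) = (\<Sum>k\<in>row_support i. P i k * first_hit i n k)"
proof -
  have "(#) i -` {w. w ! Suc n = i \<and> (\<forall>k. 0 < k \<and> k < Suc n \<longrightarrow> w ! k \<noteq> i)}
      = {w. w ! n = i \<and> (\<forall>k<n. w ! k \<noteq> i)}"
    by (auto simp: gr0_conv_Suc)
  then show ?thesis unfolding first_return_def first_hit_def prob_walk_Suc by simp
qed

lemma first_hit_sum_le: "(\<Sum>n<N. first_hit i n j) \<le> 1"
proof (induction N arbitrary: j)
  case 0
  then show ?case by simp
next
  case (Suc N)
  show ?case
  proof (cases "j = i")
    case True
    then show ?thesis
      by (subst sum.lessThan_Suc_shift) (simp add: first_hit_0 first_hit_Suc)
  next
    case False
    then have "(\<Sum>n<Suc N. first_hit i n j)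
        = (\<Sum>k\<in>row_support j. P j k * (\<Sum>n<N. first_hit i n k))"
      by (subst sum.lessThan_Suc_shift)
        (simp add: first_hit_0 first_hit_Suc sum_distrib_left, rule sum.swap)
    then show ?thesis using row_average_le[OF Suc.IH] by simp
  qed
qed

lemma first_return_sum_le: "(\<Sum>n<N. first_return P i (Suc n)) \<le> 1"
proof -
  have "(\<Sum>n<N. first_return P i (Suc n))
      = (\<Sum>k\<in>row_support i. P i k * (\<Sum>n<N. first_hit i n k))"
    by (simp add: first_return_Suc sum_distrib_left) (rule sum.swap)
  then show ?thesis using row_average_le[OF first_hit_sum_le] by simp
qed

lemma power_first_hit:
  "mat_power P n j i = (\<Sum>m\<le>n. first_hit i m j * mat_power P (n - m) i i)"
proof (induction n arbitrary: j)
  case 0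
  then show ?case by (simp add: first_hit_0)
next
  case (Suc n)
  show ?case
  proof (cases "j = i")
    case True
    then show ?thesis
      by (subst sum.atMost_Suc_shift) (simp add: first_hit_0 first_hit_Suc)
  next
    case False
    have "mat_power P (Suc n) j i
        = (\<Sum>k\<in>row_support j. \<Sum>m\<le>n. P j k * first_hit i m k * mat_power P (n - m) i i)"
      unfolding power_Suc by (intro sum.cong refl) (subst Suc, simp add: sum_distrib_left mult.assoc)
    also have "\<dots> = (\<Sum>m\<le>n. \<Sum>k\<in>row_support j. P j k * first_hit i m k * mat_power P (n - m) i i)"
      by (rule sum.swap)
    also have "\<dots> = (\<Sum>m\<le>n. first_hit i (Suc m) j * mat_power P (n - m) i i)"
      using False by (simp add: first_hit_Suc sum_distrib_right)
    also have "\<dots> = (\<Sum>m\<le>Suc n. first_hit i m j * mat_power P (Suc n - m) i i)"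
      using False by (subst sum.atMost_Suc_shift) (simp add: first_hit_0)
    finally show ?thesis .
  qed
qed

lemma power_renewal:
  "mat_power P (Suc n) i i = (\<Sum>m\<le>n. first_return P i (Suc m) * mat_power P (n - m) i i)"
proof -
  have "mat_power P (Suc n) i i
      = (\<Sum>k\<in>row_support i. \<Sum>m\<le>n. P i k * first_hit i m k * mat_power P (n - m) i i)"
    unfolding power_Suc
    by (intro sum.cong refl) (subst power_first_hit, simp add: sum_distrib_left mult.assoc)
  also have "\<dots> = (\<Sum>m\<le>n. \<Sum>k\<in>row_support i. P i k * first_hit i m k * mat_power P (n - m) i i)"
    by (rule sum.swap)
  also have "\<dots> = (\<Sum>m\<le>n. first_return P i (Suc m) * mat_power P (n - m) i i)"
    by (simp add: first_return_Suc sum_distrib_right)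
  finally show ?thesis .
qed

lemma positive_recurrent_state_iff:
  assumes "(\<lambda>n. mat_power P n i i) \<longlonglongrightarrow> L"
  shows "positive_recurrent_state P i \<longleftrightarrow> L > 0"
  unfolding positive_recurrent_state_def
proof (rule renewal_limit_pos_iff[where u = "\<lambda>n. mat_power P n i i"])
  show "0 \<le> first_return P i (Suc n)" for n
    by (simp add: first_return_def)
qed (use assms power_nonneg power_le_1 power_renewal first_return_sum_le in auto)

text \<open>
  A path from \<open>i\<close> to \<open>z\<close>, a long loop at \<open>z\<close> and a path from \<open>z\<close> to \<open>j\<close> bound the limit
  from below.
\<close>

lemma limit_pos:
  assumes lim: "\<And>i j. (\<lambda>n. mat_power P n i j) \<longlonglongrightarrow> L i j" and z: "0 < L z z"
  shows "0 < L i j"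
proof -
  obtain a where a: "0 < mat_power P a i z" using irreducible by blast
  obtain b where b: "0 < mat_power P b z j" using irreducible by blast
  have "mat_power P a i z * mat_power P n z z * mat_power P b z j \<le> mat_power P (n + (a + b)) i j" for n
  proof -
    have "mat_power P a i z * mat_power P n z z * mat_power P b z j
        \<le> mat_power P (a + n) i z * mat_power P b z j"
      by (intro mult_right_mono power_add_ge power_nonneg)
    also have "\<dots> \<le> mat_power P (a + n + b) i j" by (rule power_add_ge)
    finally show ?thesis by (simp add: ac_simps)
  qed
  moreover have "(\<lambda>n. mat_power P a i z * mat_power P n z z * mat_power P b z j)
      \<longlonglongrightarrow> mat_power P a i z * L z z * mat_power P b z j"
    by (intro tendsto_intros lim)
  moreover have "(\<lambda>n. mat_power P (n + (a + b)) i j) \<longlonglongrightarrow> L i j"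
    by (intro LIMSEQ_ignore_initial_segment lim)
  ultimately have "mat_power P a i z * L z z * mat_power P b z j \<le> L i j"
    by (intro LIMSEQ_le) auto
  moreover have "0 < mat_power P a i z * L z z * mat_power P b z j"
    using a b z by simp
  ultimately show ?thesis by linarith
qed

lemma ergodic_chain_iff:
  assumes "\<And>i j. (\<lambda>n. mat_power P n i j) \<longlonglongrightarrow> L i j"
  shows "ergodic_chain P \<longleftrightarrow> 0 < L z z"
  unfolding ergodic_chain_def
  using positive_recurrent_state_iff[OF assms] limit_pos[of L z, OF assms] by blast

text \<open>
  The vector \<open>q\<close> has infinite support, but the columns of the powers are finite, so that the two
  summations may be exchanged without an appeal to Fubini's theorem.
\<close>

lemma invariant_power:
  assumes inv: "\<And>j. (\<lambda>i. q i * P i j) sums q j"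
  shows "(\<lambda>i. q i * mat_power P n i j) sums q j"
proof (induction n)
  case 0
  have "(\<lambda>i. q i * mat_power P 0 i j) = (\<lambda>i. if i = j then q j else 0)" by auto
  then show ?case using sums_single[of j "\<lambda>_. q j"] by simp
next
  case (Suc n)
  define F where "F = {k. mat_power P n k j \<noteq> 0}"
  have F: "finite F" unfolding F_def by (rule finite_power_column)
  have "(\<lambda>k. q k * mat_power P n k j) sums (\<Sum>k\<in>F. q k * mat_power P n k j)"
    by (intro sums_finite F) (auto simp: F_def)
  with Suc have q: "(\<Sum>k\<in>F. q k * mat_power P n k j) = q j"
    using sums_unique2 by blast
  have "(\<lambda>i. \<Sum>k\<in>F. q i * P i k * mat_power P n k j) sums (\<Sum>k\<in>F. q k * mat_power P n k j)"
    by (intro sums_sum sums_mult2 inv)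
  moreover have "(\<Sum>k\<in>F. q i * P i k * mat_power P n k j) = q i * mat_power P (Suc n) i j" for i
  proof -
    have "mat_power P (Suc n) i j = (\<Sum>k\<in>row_support i \<union> F. P i k * mat_power P n k j)"
      by (rule mat_power_Suc) (use F in \<open>auto simp: row_support_def finite_row\<close>)
    also have "\<dots> = (\<Sum>k\<in>F. P i k * mat_power P n k j)"
      using F by (intro sum.mono_neutral_right) (auto simp: F_def)
    finally show ?thesis by (simp add: sum_distrib_left mult.assoc)
  qed
  ultimately show ?case by (simp add: q)
qed

lemma invariant_limit:
  assumes lim: "\<And>i j. (\<lambda>n. mat_power P n i j) \<longlonglongrightarrow> L i j"
    and q: "\<And>i. 0 \<le> q i" "summable q" and inv: "\<And>j. (\<lambda>i. q i * P i j) sums q j"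
  shows "(\<lambda>i. q i * L i j) sums q j"
proof -
  have T: "summable (\<lambda>i. norm (q i * L i j)) \<and>
      (\<lambda>n. \<Sum>i. q i * mat_power P n i j) \<longlonglongrightarrow> (\<Sum>i. q i * L i j)"
  proof (rule tannerys_theorem[THEN conjunct2])
    show "(\<lambda>n. q i * mat_power P n i j) \<longlonglongrightarrow> q i * L i j" for i
      by (intro tendsto_intros lim)
    show "eventually (\<lambda>(i, n). norm (q i * mat_power P n i j) \<le> q i) (sequentially \<times>\<^sub>F sequentially)"
      using q power_nonneg power_le_1
      by (intro always_eventually) (auto simp: abs_mult intro: mult_left_le)
  qed (use q in auto)
  have "(\<Sum>i. q i * mat_power P n i j) = q j" for n
    using invariant_power[OF inv] by (simp add: sums_iff)
  then have "(\<Sum>i. q i * L i j) = q j" using T by (simp add: LIMSEQ_const_iff)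
  then show ?thesis using T by (metis summable_norm_cancel summable_sums)
qed

lemma limit_row_sum_le:
  assumes lim: "\<And>i j. (\<lambda>n. mat_power P n i j) \<longlonglongrightarrow> L i j"
  shows "(\<Sum>j\<le>N. L i j) \<le> 1"
proof (rule LIMSEQ_le_const2)
  show "(\<lambda>n. \<Sum>j\<le>N. mat_power P n i j) \<longlonglongrightarrow> (\<Sum>j\<le>N. L i j)"
    by (intro tendsto_intros lim)
  show "\<exists>M. \<forall>n\<ge>M. (\<Sum>j\<le>N. mat_power P n i j) \<le> 1"
    using power_row_sum_le by auto
qed

lemma power_Suc_right:
  assumes F: "finite F" "{i. P i j \<noteq> 0} \<subseteq> F"
  shows "mat_power P (Suc n) i j = (\<Sum>k\<in>F. mat_power P n i k * P k j)"
proof (induction n arbitrary: i)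
  case 0
  have "mat_power P (Suc 0) i j = (\<Sum>k\<in>insert j (row_support i). P i k * mat_power P 0 k j)"
    by (rule mat_power_Suc) (auto simp: row_support_def finite_row)
  also have "\<dots> = P i j"
    by (subst sum.remove[of _ j]) auto
  also have "\<dots> = (\<Sum>k\<in>insert i F. mat_power P 0 i k * P k j)"
    using F(1) by (subst sum.remove[of _ i]) auto
  also have "\<dots> = (\<Sum>k\<in>F. mat_power P 0 i k * P k j)"
    using F by (intro sum.mono_neutral_right) auto
  finally show ?case .
next
  case (Suc n)
  have "mat_power P (Suc (Suc n)) i j
      = (\<Sum>l\<in>row_support i. \<Sum>k\<in>F. P i l * mat_power P n l k * P k j)"
    by (subst power_Suc) (simp add: Suc sum_distrib_left mult.assoc)
  also have "\<dots> = (\<Sum>k\<in>F. \<Sum>l\<in>row_support i. P i l * mat_power P n l k * P k j)"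
    by (rule sum.swap)
  finally show ?case by (simp add: power_Suc sum_distrib_right)
qed

lemma limit_row_invariant:
  assumes lim: "\<And>i j. (\<lambda>n. mat_power P n i j) \<longlonglongrightarrow> L i j"
  shows "(\<lambda>k. L i k * P k j) sums L i j"
proof -
  define F where "F = {k. P k j \<noteq> 0}"
  have F: "finite F" "{k. P k j \<noteq> 0} \<subseteq> F"
    by (auto simp: F_def finite_column)
  have "(\<lambda>n. \<Sum>k\<in>F. mat_power P n i k * P k j) \<longlonglongrightarrow> (\<Sum>k\<in>F. L i k * P k j)"
    by (intro tendsto_intros lim)
  moreover have "(\<lambda>n. \<Sum>k\<in>F. mat_power P n i k * P k j) \<longlonglongrightarrow> L i j"
    using LIMSEQ_Suc[OF lim[of i j]] by (simp only: power_Suc_right[OF F])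
  ultimately have "(\<Sum>k\<in>F. L i k * P k j) = L i j" by (rule LIMSEQ_unique)
  moreover have "(\<lambda>k. L i k * P k j) sums (\<Sum>k\<in>F. L i k * P k j)"
    using F by (intro sums_finite) auto
  ultimately show ?thesis by simp
qed

text \<open>
  Rescale so that the limit matrix is \<open>g\<^sub>i v\<^sub>j\<close> with \<open>g\<^sub>z = 1\<close>, and let \<open>s\<close> be the sum of \<open>v\<close>. The row sums
  give \<open>g\<^sub>k s \<le> 1\<close> for all \<open>k\<close>. On the other hand \<open>v\<close> is invariant, hence fixed by the limit matrix,
  which means \<open>\<Sum>\<^sub>k v\<^sub>k g\<^sub>k = 1\<close>. So the nonnegative terms \<open>v\<^sub>k (1 - g\<^sub>k s)\<close> have sum \<open>s - s = 0\<close>, and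
  \<open>g\<^sub>k = 1 / s\<close> for all \<open>k\<close>; finally \<open>g\<^sub>z = 1\<close> gives \<open>s = 1\<close>.
\<close>

lemma rank_one_limit:
  assumes lim: "\<And>i j. (\<lambda>n. mat_power P n i j) \<longlonglongrightarrow> h i * w j" and z: "0 < h z * w z"
  shows "stationary_distribution P (\<lambda>j. h j * w j)"
    and "h i * w j = h j * w j"
proof -
  define v where "v j = h z * w j" for j
  define g where "g i = h i / h z" for i
  have hz: "h z \<noteq> 0" using z by auto
  have L: "h i * w j = g i * v j" for i j using hz by (simp add: g_def v_def)
  have gz: "g z = 1" using hz by (simp add: g_def)
  note lim' = lim[unfolded L]
  have Lpos: "0 < g i * v j" for i j
    using limit_pos[of "\<lambda>i j. h i * w j" z, OF lim z] by (simp add: L)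
  have v: "0 < v j" for j using Lpos[of z j] gz by simp
  have g: "0 < g i" for i using Lpos[of i z] v[of z] by (simp add: zero_less_mult_iff)
  have rows: "(\<Sum>j\<le>N. g i * v j) \<le> 1" for i N
    using limit_row_sum_le[OF lim'] .
  have sv: "summable v"
    by (rule bounded_imp_summable[where B = 1]) (use v rows[of z] gz in \<open>auto simp: less_imp_le\<close>)
  define s where "s = suminf v"
  have vs: "v sums s" using sv by (simp add: s_def summable_sums)
  have spos: "0 < s" unfolding s_def using sv v by (intro suminf_pos) auto
  have gs: "g i * s \<le> 1" for i
  proof -
    have "(\<Sum>j. g i * v j) \<le> 1"
    proof (rule suminf_le_const)
      show "summable (\<lambda>j. g i * v j)" using sv by (rule summable_mult)
      show "(\<Sum>j<N. g i * v j) \<le> 1" for N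
        by (rule order_trans[OF sum_mono2 rows[of i N]]) (auto intro: less_imp_le[OF Lpos])
    qed
    then show ?thesis using sv by (simp add: s_def suminf_mult)
  qed
  have inv: "(\<lambda>k. v k * P k j) sums v j" for j
    using limit_row_invariant[OF lim', of z j] gz by simp
  have "(\<lambda>k. v k * (g k * v z)) sums v z"
    using invariant_limit[OF lim' _ sv inv] v by (simp add: less_imp_le)
  from sums_divide[OF this, of "v z"] have vg: "(\<lambda>k. v k * g k) sums 1"
    using v[of z] by simp
  have "(\<lambda>k. v k * (1 - g k * s)) sums (s - 1 * s)"
    using sums_diff[OF vs sums_mult2[OF vg, of s]] by (simp add: algebra_simps)
  then have "(\<lambda>k. v k * (1 - g k * s)) sums 0" by simp
  moreover have nn: "0 \<le> v k * (1 - g k * s)" for k using v[of k] gs[of k] by simp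
  ultimately have "v k * (1 - g k * s) = 0" for k
    using suminf_eq_zero_iff[of "\<lambda>k. v k * (1 - g k * s)"] by (auto simp: sums_iff)
  then have gs1: "g k * s = 1" for k using v[of k] by (metis less_irrefl mult_eq_0_iff right_minus_eq)
  then have s1: "s = 1" using gs1[of z] gz by simp
  then have g1: "g k = 1" for k using gs1[of k] by simp
  show "h i * w j = h j * w j" by (simp add: L g1)
  show "stationary_distribution P (\<lambda>j. h j * w j)"
    unfolding stationary_distribution_def L g1 using v vs inv s1 by (auto simp: less_imp_le)
qed

lemma stationary_distribution_unique:
  assumes lim: "\<And>i j. (\<lambda>n. mat_power P n i j) \<longlonglongrightarrow> w j" and q: "stationary_distribution P q"
  shows "q = w"
proof
  fix j
  have q': "\<And>i. 0 \<le> q i" "q sums 1" "\<And>j. (\<lambda>i. q i * P i j) sums q j"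
    using q by (auto simp: stationary_distribution_def)
  have "(\<lambda>i. q i * w j) sums q j"
    using invariant_limit[OF lim q'(1) _ q'(3)] q'(2) by (simp add: sums_iff)
  moreover have "(\<lambda>i. q i * w j) sums (1 * w j)" by (intro sums_mult2 q')
  ultimately show "q j = w j" using sums_unique2 by fastforce
qed

lemma stationary_distribution_iff:
  assumes lim: "\<And>i j. (\<lambda>n. mat_power P n i j) \<longlonglongrightarrow> h i * w j" and z: "0 < h z * w z"
  shows "stationary_distribution P q \<longleftrightarrow> q = (\<lambda>j. h j * w j)"
proof -
  note ro = rank_one_limit[OF lim z]
  have "(\<lambda>n. mat_power P n i j) \<longlonglongrightarrow> h j * w j" for i j
    using lim[of i j] ro(2)[of i j] by simp
  from stationary_distribution_unique[OF this] ro(1) show ?thesis by blast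
qed

end

section \<open>Integration of polynomials over the unit interval\<close>

lemma set_integrable_poly:
  assumes "unit_interval_measure \<mu>"
  shows "set_integrable \<mu> {0..1} (poly q)"
proof -
  interpret finite_measure \<mu> using assms by (simp add: unit_interval_measure_def)
  have sets: "sets \<mu> = sets borel" using assms by (simp add: unit_interval_measure_def)
  have "bounded (poly q ` {0..1})"
    by (intro compact_imp_bounded compact_continuous_image continuous_intros compact_Icc)
  then obtain K where "\<forall>y\<in>poly q ` {0..1}. norm y \<le> K"
    unfolding bounded_iff by blast
  then have K: "\<And>x. x \<in> {0..1} \<Longrightarrow> norm (poly q x) \<le> K" by auto
  show ?thesis unfolding set_integrable_def
  proof (rule integrable_const_bound[where B = "\<bar>K\<bar>"])
    show "AE x in \<mu>. norm (indicat_real {0..1} x *\<^sub>R poly q x) \<le> \<bar>K\<bar>"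
      using K by (intro always_eventually) (fastforce simp: indicator_def)
    show "(\<lambda>x. indicat_real {0..1} x *\<^sub>R poly q x) \<in> borel_measurable \<mu>"
      unfolding measurable_cong_sets[OF sets refl]
      by (intro borel_measurable_scaleR borel_measurable_indicator borel_measurable_continuous_onI
          continuous_intros) auto
  qed
qed

lemma LIMSEQ_integral_power_mult_poly:
  assumes \<mu>: "unit_interval_measure \<mu>"
  shows "(\<lambda>n. LINT x:{0..1}|\<mu>. x ^ n * poly q x) \<longlonglongrightarrow> poly q 1 * measure \<mu> {1}"
proof -
  interpret finite_measure \<mu> using \<mu> by (simp add: unit_interval_measure_def)
  have sets: "sets \<mu> = sets borel" using \<mu> by (simp add: unit_interval_measure_def)
  have int: "integrable \<mu> (\<lambda>x. indicat_real {0..1} x * (x ^ n * poly q x))" for n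
    using set_integrable_poly[OF \<mu>, of "[:0, 1:] ^ n * q"] by (simp add: set_integrable_def poly_power)
  have "(\<lambda>n. \<integral>x. indicat_real {0..1} x * (x ^ n * poly q x) \<partial>\<mu>)
      \<longlonglongrightarrow> (\<integral>x. indicat_real {1} x * poly q 1 \<partial>\<mu>)"
  proof (rule integral_dominated_convergence)
    show "integrable \<mu> (\<lambda>x. norm (indicat_real {0..1} x * (x ^ 0 * poly q x)))"
      using int[of 0] by (rule integrable_norm)
    show "AE x in \<mu>. (\<lambda>n. indicat_real {0..1} x * (x ^ n * poly q x)) \<longlonglongrightarrow> indicat_real {1} x * poly q 1"
    proof (intro always_eventually allI)
      fix x :: real
      consider "x \<notin> {0..1}" | "x = 1" | "0 \<le> x" "x < 1" by fastforce
      then show "(\<lambda>n. indicat_real {0..1} x * (x ^ n * poly q x)) \<longlonglongrightarrow> indicat_real {1} x * poly q 1"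
      proof cases
        case 3
        then have "(\<lambda>n. x ^ n * poly q x) \<longlonglongrightarrow> 0 * poly q x"
          by (intro tendsto_intros LIMSEQ_power_zero) auto
        then show ?thesis using 3 by simp
      qed auto
    qed
    show "AE x in \<mu>. norm (indicat_real {0..1} x * (x ^ n * poly q x))
        \<le> norm (indicat_real {0..1} x * (x ^ 0 * poly q x))" for n
      by (intro always_eventually allI)
        (auto simp: indicator_def abs_mult power_abs[symmetric] intro!: mult_left_le_one_le power_le_one)
    show "(\<lambda>x. indicat_real {1} x * poly q 1) \<in> borel_measurable \<mu>"
      unfolding measurable_cong_sets[OF sets refl] by measurable
    show "(\<lambda>x. indicat_real {0..1} x * (x ^ n * poly q x)) \<in> borel_measurable \<mu>" for n
      using int by (rule borel_measurable_integrable)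
  qed
  also have "(\<integral>x. indicat_real {1} x * poly q 1 \<partial>\<mu>) = poly q 1 * measure \<mu> {1}"
    using sets by (simp add: sets_eq_imp_space_eq)
  finally show ?thesis by (simp add: set_lebesgue_integral_def)
qed

text \<open>
  The indices are ordered such that the mixed moment of order \<open>n\<close> is the entry of \<open>T\<^sup>n\<close> in row \<open>i\<close> and
  column \<open>j\<close>.
\<close>

definition mixed_moment ::
  "nat \<Rightarrow> (nat \<Rightarrow> nat \<Rightarrow> real poly) \<Rightarrow> (nat \<Rightarrow> real poly) \<Rightarrow> (nat \<Rightarrow> real measure) \<Rightarrow> nat \<Rightarrow> inf_mat" where
  "mixed_moment p A B \<psi> n i j =
     (\<Sum>a\<in>{1..p}. LINT x:{0..1}|\<psi> a. x ^ n * (poly (A a j) x * poly (B i) x))"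

definition linear_form_at_1 ::
  "nat \<Rightarrow> (nat \<Rightarrow> nat \<Rightarrow> real poly) \<Rightarrow> (nat \<Rightarrow> real measure) \<Rightarrow> nat \<Rightarrow> real" where
  "linear_form_at_1 p A \<psi> n = (\<Sum>a\<in>{1..p}. poly (A a n) 1 * measure (\<psi> a) {1})"

lemma mixed_moment_0:
  assumes "associated_measures p A B \<psi>"
  shows "mixed_moment p A B \<psi> 0 i j = of_bool (i = j)"
  using assms by (auto simp: associated_measures_def mixed_moment_def)

lemma LIMSEQ_mixed_moment:
  assumes "associated_measures p A B \<psi>"
  shows "(\<lambda>n. mixed_moment p A B \<psi> n i j) \<longlonglongrightarrow> poly (B i) 1 * linear_form_at_1 p A \<psi> j"
proof -
  have "(\<lambda>n. LINT x:{0..1}|\<psi> a. x ^ n * poly (A a j * B i) x)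
      \<longlonglongrightarrow> poly (A a j * B i) 1 * measure (\<psi> a) {1}" if "a \<in> {1..p}" for a
    using assms that by (intro LIMSEQ_integral_power_mult_poly) (auto simp: associated_measures_def)
  then have "(\<lambda>n. mixed_moment p A B \<psi> n i j)
      \<longlonglongrightarrow> (\<Sum>a\<in>{1..p}. poly (A a j * B i) 1 * measure (\<psi> a) {1})"
    unfolding mixed_moment_def by (intro tendsto_sum) simp
  then show ?thesis
    by (simp add: linear_form_at_1_def sum_distrib_left mult_ac)
qed

lemma set_integral_poly_sum:
  assumes \<mu>: "unit_interval_measure \<mu>" and fin: "finite S"
    and g: "\<And>x. g x = (\<Sum>k\<in>S. c k * poly (q k) x)"
  shows "(LINT x:{0..1}|\<mu>. g x) = (\<Sum>k\<in>S. c k * (LINT x:{0..1}|\<mu>. poly (q k) x))"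
proof -
  have "integrable \<mu> (\<lambda>x. indicat_real {0..1} x * poly (q k) x)" for k
    using set_integrable_poly[OF \<mu>, of "q k"] by (simp add: set_integrable_def)
  then show ?thesis
    by (simp add: set_lebesgue_integral_def g sum_distrib_left mult.left_commute)
qed

text \<open>
  One factor \<open>x\<close> of the moment is absorbed by the recursion of the type II polynomials in the first
  lemma, which amounts to \<open>T\<^sup>n\<^sup>+\<^sup>1 = T T\<^sup>n\<close>, and by that of the type I polynomials in the second, which
  amounts to \<open>T\<^sup>n\<^sup>+\<^sup>1 = T\<^sup>n T\<close>. The latter is the recursion for the powers of the transpose of \<open>T\<close>.
\<close>

lemma mixed_moment_Suc_left:
  assumes \<psi>: "associated_measures p A B \<psi>" and S: "finite S"
    and B: "[:0, 1:] * B i = (\<Sum>k\<in>S. Polynomial.smult (c k) (B k))"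
  shows "mixed_moment p A B \<psi> (Suc n) i j = (\<Sum>k\<in>S. c k * mixed_moment p A B \<psi> n k j)"
proof -
  have B': "x * poly (B i) x = (\<Sum>k\<in>S. c k * poly (B k) x)" for x
    using arg_cong[OF B, of "\<lambda>q. poly q x"] by (simp add: poly_sum)
  have "(LINT x:{0..1}|\<psi> a. x ^ Suc n * (poly (A a j) x * poly (B i) x))
      = (\<Sum>k\<in>S. c k * (LINT x:{0..1}|\<psi> a. poly ([:0, 1:] ^ n * (A a j * B k)) x))"
    if "a \<in> {1..p}" for a
  proof (rule set_integral_poly_sum[OF _ S])
    show "unit_interval_measure (\<psi> a)" using \<psi> that by (simp add: associated_measures_def)
    have "x ^ Suc n * (poly (A a j) x * poly (B i) x) = x ^ n * poly (A a j) x * (x * poly (B i) x)" for x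
      by (simp add: mult_ac)
    then show "x ^ Suc n * (poly (A a j) x * poly (B i) x)
        = (\<Sum>k\<in>S. c k * poly ([:0, 1:] ^ n * (A a j * B k)) x)" for x
      by (simp add: B' sum_distrib_left poly_power mult_ac)
  qed
  then have "mixed_moment p A B \<psi> (Suc n) i j
      = (\<Sum>a\<in>{1..p}. \<Sum>k\<in>S. c k * (LINT x:{0..1}|\<psi> a. x ^ n * (poly (A a j) x * poly (B k) x)))"
    unfolding mixed_moment_def by (intro sum.cong) (simp_all add: poly_power)
  also have "\<dots> = (\<Sum>k\<in>S. c k * mixed_moment p A B \<psi> n k j)"
    unfolding mixed_moment_def sum_distrib_left by (rule sum.swap)
  finally show ?thesis .
qed

lemma mixed_moment_Suc_right:
  assumes \<psi>: "associated_measures p A B \<psi>" and S: "finite S"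
    and A: "\<And>a. a \<in> {1..p} \<Longrightarrow> [:0, 1:] * A a j = (\<Sum>k\<in>S. Polynomial.smult (c k) (A a k))"
  shows "mixed_moment p A B \<psi> (Suc n) i j = (\<Sum>k\<in>S. c k * mixed_moment p A B \<psi> n i k)"
proof -
  have "(LINT x:{0..1}|\<psi> a. x ^ Suc n * (poly (A a j) x * poly (B i) x))
      = (\<Sum>k\<in>S. c k * (LINT x:{0..1}|\<psi> a. poly ([:0, 1:] ^ n * (A a k * B i)) x))"
    if a: "a \<in> {1..p}" for a
  proof (rule set_integral_poly_sum[OF _ S])
    show "unit_interval_measure (\<psi> a)" using \<psi> a by (simp add: associated_measures_def)
    have A': "x * poly (A a j) x = (\<Sum>k\<in>S. c k * poly (A a k) x)" for x
      using arg_cong[OF A[OF a], of "\<lambda>q. poly q x"] by (simp add: poly_sum)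
    have "x ^ Suc n * (poly (A a j) x * poly (B i) x) = x ^ n * poly (B i) x * (x * poly (A a j) x)" for x
      by (simp add: mult_ac)
    then show "x ^ Suc n * (poly (A a j) x * poly (B i) x)
        = (\<Sum>k\<in>S. c k * poly ([:0, 1:] ^ n * (A a k * B i)) x)" for x
      by (simp add: A' sum_distrib_left poly_power mult_ac)
  qed
  then have "mixed_moment p A B \<psi> (Suc n) i j
      = (\<Sum>a\<in>{1..p}. \<Sum>k\<in>S. c k * (LINT x:{0..1}|\<psi> a. x ^ n * (poly (A a k) x * poly (B i) x)))"
    unfolding mixed_moment_def by (intro sum.cong) (simp_all add: poly_power)
  also have "\<dots> = (\<Sum>k\<in>S. c k * mixed_moment p A B \<psi> n i k)"
    unfolding mixed_moment_def sum_distrib_left by (rule sum.swap)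
  finally show ?thesis .
qed

section \<open>The recursions in matrix form\<close>

definition hessenberg_banded :: "nat \<Rightarrow> inf_mat \<Rightarrow> bool" where
  "hessenberg_banded p T \<longleftrightarrow> (\<forall>n. T n (Suc n) = 1) \<and> (\<forall>i j. j > Suc i \<or> j + p < i \<longrightarrow> T i j = 0)"

lemma type_II_recursion:
  assumes T: "hessenberg_banded p T" and B: "type_II_polynomials p T B"
  shows "[:0, 1:] * B i = (\<Sum>k\<le>Suc i. Polynomial.smult (T i k) (B k))"
proof -
  have "(\<Sum>k<i. Polynomial.smult (T i k) (B k)) = (\<Sum>k\<in>{i - p..<i}. Polynomial.smult (T i k) (B k))"
    using T by (intro sum.mono_neutral_right) (auto simp: hessenberg_banded_def)
  moreover have "{..Suc i} = insert (Suc i) (insert i {..<i})" by auto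
  moreover have "B (Suc i) = [:- T i i, 1:] * B i - (\<Sum>k\<in>{i - p..<i}. Polynomial.smult (T i k) (B k))"
    using B by (simp add: type_II_polynomials_def)
  ultimately show ?thesis using T by (simp add: hessenberg_banded_def)
qed

lemma type_I_recursion:
  assumes T: "hessenberg_banded p T" and A: "type_I_polynomials p T \<nu> A" and a: "a \<in> {1..p}"
  shows "[:0, 1:] * A a j = (\<Sum>k\<le>j + p. Polynomial.smult (T k j) (A a k))"
proof -
  have "(\<Sum>k\<le>j + p. Polynomial.smult (T k j) (A a k))
      = (\<Sum>k<j. Polynomial.smult (T k j) (A a k)) + (\<Sum>k\<in>{j..j + p}. Polynomial.smult (T k j) (A a k))"
    by (subst sum.union_disjoint[symmetric]) (auto intro!: sum.cong)
  also have "(\<Sum>k<j. Polynomial.smult (T k j) (A a k)) = (if j = 0 then 0 else A a (j - 1))"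
  proof (cases j)
    case (Suc i)
    have "(\<Sum>k<j. Polynomial.smult (T k j) (A a k)) = (\<Sum>k\<in>{i}. Polynomial.smult (T k j) (A a k))"
      using T Suc by (intro sum.mono_neutral_right) (auto simp: hessenberg_banded_def)
    then show ?thesis using T Suc by (simp add: hessenberg_banded_def)
  qed simp
  also have "(\<Sum>k\<in>{j..j + p}. Polynomial.smult (T k j) (A a k))
      = (\<Sum>k\<le>p. Polynomial.smult (T (j + k) j) (A a (j + k)))"
    by (rule sum.reindex_bij_witness[of _ "\<lambda>k. j + k" "\<lambda>k. k - j"]) auto
  finally show ?thesis using A a by (simp add: type_I_polynomials_def)
qed

text \<open>Only the first type I polynomial of index 0 is nonzero, as \<open>\<nu>\<close> is lower unitriangular.\<close>

lemma linear_form_at_1_0: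
  assumes "p \<ge> 1" "lower_unitriangular p \<nu>" "type_I_polynomials p T \<nu> A"
  shows "linear_form_at_1 p A \<psi> 0 = measure (\<psi> 1) {1}"
proof -
  have "poly (A a 0) 1 = of_bool (a = 1)" if "a \<in> {1..p}" for a
  proof -
    have \<nu>: "\<nu> $$ (0, a - 1) = of_bool (a = 1)"
      using assms(1,2) that unfolding lower_unitriangular_def upper_unitriangular_def upper_triangular_def
      by (cases "a = 1") (auto dest: spec[of _ "a - 1"] spec[of _ 0])
    have "A a 0 = [:\<nu> $$ (0, a - 1):]"
      using assms(1,3) that unfolding type_I_polynomials_def by (auto simp: Suc_le_eq)
    then show ?thesis by (simp only: \<nu>) simp
  qed
  then have "linear_form_at_1 p A \<psi> 0 = (\<Sum>a\<in>{1..p}. of_bool (a = 1) * measure (\<psi> a) {1})"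
    unfolding linear_form_at_1_def by (intro sum.cong) auto
  also have "\<dots> = measure (\<psi> 1) {1}"
    using assms(1) by (subst sum.remove[of _ 1]) auto
  finally show ?thesis .
qed

section \<open>Stochastic bidiagonal factorizations\<close>

text \<open>
  A common property of the lower and the upper factors that suffices for positivity: the diagonal
  entries of the other factors carry a positive entry of one factor over to the product.
\<close>

definition nonneg_tridiagonal :: "inf_mat \<Rightarrow> bool" where
  "nonneg_tridiagonal M \<longleftrightarrow> (\<forall>i j. 0 \<le> M i j) \<and> (\<forall>i. 0 < M i i) \<and>
     (\<forall>i j. j > Suc i \<or> i > Suc j \<longrightarrow> M i j = 0)"

lemma lower_bidiagonal_nonneg_tridiagonal:
  assumes "lower_bidiagonal_stochastic L"
  shows "nonneg_tridiagonal L"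
proof -
  have z: "i \<noteq> j \<Longrightarrow> i \<noteq> Suc j \<Longrightarrow> L i j = 0" and d: "0 < L i i" and s: "0 < L (Suc i) i" for i j
    using assms by (cases i; auto simp: lower_bidiagonal_stochastic_def)+
  have "0 \<le> L i j" for i j using z[of i j] d[of i] s[of j] by (cases "i = j"; cases "i = Suc j") auto
  then show ?thesis using z d by (auto simp: nonneg_tridiagonal_def)
qed

lemma upper_bidiagonal_nonneg_tridiagonal:
  assumes "upper_bidiagonal_stochastic U"
  shows "nonneg_tridiagonal U"
proof -
  have z: "j \<noteq> i \<Longrightarrow> j \<noteq> Suc i \<Longrightarrow> U i j = 0" and d: "0 < U i i" and s: "0 < U i (Suc i)" for i j
    using assms by (auto simp: upper_bidiagonal_stochastic_def)
  have "0 \<le> U i j" for i j using z[of j i] d[of i] s[of i] by (cases "j = i"; cases "j = Suc i") auto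
  then show ?thesis using z d by (auto simp: nonneg_tridiagonal_def)
qed

lemma inf_mat_prod_ge:
  assumes M: "nonneg_tridiagonal M" and nonneg: "\<And>i j. 0 \<le> inf_mat_prod Ms i j"
  shows "0 \<le> inf_mat_prod (M # Ms) i j" and "M i k * inf_mat_prod Ms k j \<le> inf_mat_prod (M # Ms) i j"
proof -
  have eq: "inf_mat_prod (M # Ms) i j = (\<Sum>k\<le>Suc i. M i k * inf_mat_prod Ms k j)"
  proof -
    have "inf_mat_prod (M # Ms) i j = (\<Sum>k. M i k * inf_mat_prod Ms k j)"
      by (simp add: inf_mat_prod_def inf_mat_mult_def)
    also have "\<dots> = (\<Sum>k\<le>Suc i. M i k * inf_mat_prod Ms k j)"
      using M by (intro suminf_finite) (auto simp: nonneg_tridiagonal_def)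
    finally show ?thesis .
  qed
  have nn: "0 \<le> M i k * inf_mat_prod Ms k j" for k
    using M nonneg by (simp add: nonneg_tridiagonal_def)
  show "0 \<le> inf_mat_prod (M # Ms) i j" unfolding eq by (intro sum_nonneg nn)
  show "M i k * inf_mat_prod Ms k j \<le> inf_mat_prod (M # Ms) i j"
  proof (cases "k \<le> Suc i")
    case True
    then show ?thesis unfolding eq by (intro member_le_sum nn) auto
  next
    case False
    then have "M i k = 0" using M by (simp add: nonneg_tridiagonal_def)
    then show ?thesis unfolding eq by (simp add: sum_nonneg nn del: sum.atMost_Suc)
  qed
qed

lemma inf_mat_prod_nonneg_diagonal_pos:
  assumes "\<forall>M\<in>set Ms. nonneg_tridiagonal M"
  shows "0 \<le> inf_mat_prod Ms i j \<and> 0 < inf_mat_prod Ms i i"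
  using assms
proof (induction Ms arbitrary: i j)
  case Nil
  then show ?case by (simp add: inf_mat_prod_def inf_mat_one_def)
next
  case (Cons M Ms)
  then have M: "nonneg_tridiagonal M" and nn: "\<And>i j. 0 \<le> inf_mat_prod Ms i j"
    and d: "0 < inf_mat_prod Ms i i" by auto
  have "0 < M i i * inf_mat_prod Ms i i" using M d by (simp add: nonneg_tridiagonal_def)
  then show ?case using inf_mat_prod_ge[OF M nn] by (meson less_le_trans)
qed

lemma inf_mat_prod_entry_pos:
  assumes "\<forall>M\<in>set Ms. nonneg_tridiagonal M" and "M \<in> set Ms" and "0 < M i j"
  shows "0 < inf_mat_prod Ms i j"
  using assms
proof (induction Ms)
  case Nil
  then show ?case by simp
next
  case (Cons N Ms)
  have N: "nonneg_tridiagonal N" using Cons.prems by simp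
  have nn: "0 \<le> inf_mat_prod Ms i j" and d: "0 < inf_mat_prod Ms i i" for i j
    using inf_mat_prod_nonneg_diagonal_pos Cons.prems by auto
  note ge = inf_mat_prod_ge(2)[OF N nn]
  show ?case
  proof (cases "M = N")
    case True
    then have "0 < N i j * inf_mat_prod Ms j j" using Cons.prems d by simp
    then show ?thesis using ge by (rule less_le_trans)
  next
    case False
    then have "0 < inf_mat_prod Ms i j" using Cons by auto
    then have "0 < N i i * inf_mat_prod Ms i j" using N by (simp add: nonneg_tridiagonal_def)
    then show ?thesis using ge by (rule less_le_trans)
  qed
qed

lemma inf_mat_prod_neighbours_pos:
  assumes "\<forall>M\<in>set Ms. nonneg_tridiagonal M"
    and "L \<in> set Ms" "lower_bidiagonal_stochastic L"
    and "U \<in> set Ms" "upper_bidiagonal_stochastic U"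
  shows "0 < inf_mat_prod Ms k (Suc k)" and "0 < inf_mat_prod Ms (Suc k) k"
  using assms inf_mat_prod_entry_pos[of Ms L "Suc k" k] inf_mat_prod_entry_pos[of Ms U k "Suc k"]
  by (auto simp: lower_bidiagonal_stochastic_def upper_bidiagonal_stochastic_def)

lemma psbf_type_II_neighbours_pos:
  assumes "p \<ge> 1" "psbf_type_II p P"
  shows "0 < P k (Suc k)" and "0 < P (Suc k) k"
proof -
  obtain L U where L: "\<forall>a\<in>{1..p}. lower_bidiagonal_stochastic (L a)"
    and U: "upper_bidiagonal_stochastic U" and P: "P = inf_mat_prod (map L [1..<Suc p] @ [U])"
    using assms(2) unfolding psbf_type_II_def by blast
  have "\<forall>M\<in>set (map L [1..<Suc p] @ [U]). nonneg_tridiagonal M"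
    using L U lower_bidiagonal_nonneg_tridiagonal upper_bidiagonal_nonneg_tridiagonal by auto
  note pos = inf_mat_prod_neighbours_pos[OF this _ _ _ U, of "L 1" k]
  have "L 1 \<in> set (map L [1..<Suc p] @ [U])" "lower_bidiagonal_stochastic (L 1)"
    using assms(1) L by (auto simp del: upt_Suc)
  from pos[OF this] show "0 < P k (Suc k)" "0 < P (Suc k) k" unfolding P by simp_all
qed

lemma psbf_type_I_neighbours_pos:
  assumes "p \<ge> 1" "psbf_type_I p P"
  shows "0 < P k (Suc k)" and "0 < P (Suc k) k"
proof -
  obtain L U where L: "lower_bidiagonal_stochastic L"
    and U: "\<forall>a\<in>{1..p}. upper_bidiagonal_stochastic (U a)"
    and P: "P = inf_mat_prod (L # map U (rev [1..<Suc p]))"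
    using assms(2) unfolding psbf_type_I_def by blast
  have "\<forall>M\<in>set (L # map U (rev [1..<Suc p])). nonneg_tridiagonal M"
    using L U lower_bidiagonal_nonneg_tridiagonal upper_bidiagonal_nonneg_tridiagonal by auto
  note pos = inf_mat_prod_neighbours_pos[OF this _ L, of "U 1" k]
  have "U 1 \<in> set (L # map U (rev [1..<Suc p]))" "upper_bidiagonal_stochastic (U 1)"
    using assms(1) U by (auto simp del: upt_Suc)
  from pos[OF _ this] show "0 < P k (Suc k)" "0 < P (Suc k) k" unfolding P by simp_all
qed

lemma irreducible_chain_banded:
  assumes stoch: "stochastic_matrix P" and band: "\<And>i j. j > i + p \<or> j + p < i \<Longrightarrow> P i j = 0"
    and up: "\<And>k. 0 < P k (Suc k)" and down: "\<And>k. 0 < P (Suc k) k"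
  shows "irreducible_chain P"
proof
  show "stochastic_matrix P" by (rule stoch)
  have "{k. P i k \<noteq> 0} \<subseteq> {..i + p}" for i using band by (force simp: not_le[symmetric])
  then show fr: "finite {k. P i k \<noteq> 0}" for i by (rule finite_subset) simp
  have "{i. P i j \<noteq> 0} \<subseteq> {..j + p}" for j using band by (force simp: not_le[symmetric])
  then show "finite {i. P i j \<noteq> 0}" for j by (rule finite_subset) simp
  have nn: "0 \<le> P i j" for i j using stoch by (simp add: stochastic_matrix_def)
  have Suc: "mat_power P (Suc n) i j = (\<Sum>k | P i k \<noteq> 0. P i k * mat_power P n k j)" for n i j
    by (rule mat_power_Suc) (auto simp: fr)
  have pn: "0 \<le> mat_power P n i j" for n i j
    by (rule mat_power_nonneg[OF nn fr])
  have step: "0 < mat_power P (Suc n) i j" if "0 < P i k" "0 < mat_power P n k j" for n i j k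
    unfolding Suc by (rule sum_pos2[of _ k]) (use that fr nn pn in auto)
  have "0 < mat_power P d i (i + d)" for i d
    by (induction d arbitrary: i) (use step up in \<open>fastforce\<close>)+
  moreover have "0 < mat_power P d (j + d) j" for j d
    by (induction d) (use step[OF down] in auto)
  ultimately show "\<exists>n. 0 < mat_power P n i j" for i j
    by (metis le_Suc_ex linear)
qed

section \<open>The limit of the transition probabilities\<close>

text \<open>
  The diagonal conjugations are normalised such that the entries of \<open>P\<close> just above the diagonal
  (type II), respectively just below it (type I), become the entries 1 above the diagonal of \<open>T\<close>.
\<close>

lemma hessenberg_of_type_II_banded:
  assumes band: "\<And>i j. j > i + 1 \<or> j + p < i \<Longrightarrow> P i j = 0" and up: "\<And>k. 0 < P k (Suc k)"
    and T: "hessenberg_of_type_II P T"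
  shows "pi_II P i \<noteq> 0" and "hessenberg_banded p T"
proof -
  have up0: "P k (Suc k) \<noteq> 0" for k using up[of k] by simp
  show nz: "pi_II P i \<noteq> 0" for i using up0 by (simp add: pi_II_def)
  have Teq: "T i j = P i j * pi_II P j / pi_II P i" for i j
    using T nz by (simp add: hessenberg_of_type_II_def)
  have "T n (Suc n) = 1" for n
    using up0 by (simp add: Teq pi_II_def)
  moreover have "T i j = 0" if "j > Suc i \<or> j + p < i" for i j
    using band[of i j] that by (simp add: Teq)
  ultimately show "hessenberg_banded p T" by (simp add: hessenberg_banded_def)
qed

lemma hessenberg_of_type_I_banded:
  assumes band: "\<And>i j. j > i + p \<or> j + 1 < i \<Longrightarrow> P i j = 0" and down: "\<And>k. 0 < P (Suc k) k"
    and T: "hessenberg_of_type_I P T"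
  shows "pi_I P i \<noteq> 0" and "hessenberg_banded p T"
proof -
  have down0: "P (Suc k) k \<noteq> 0" for k using down[of k] by simp
  show nz: "pi_I P i \<noteq> 0" for i using down0 by (simp add: pi_I_def)
  have Teq: "T j i = P i j * pi_I P i / pi_I P j" for i j
    using T nz by (simp add: hessenberg_of_type_I_def)
  have "T n (Suc n) = 1" for n
    using down0 by (simp add: Teq pi_I_def)
  moreover have "T i j = 0" if "j > Suc i \<or> j + p < i" for i j
    using band[of j i] that by (auto simp: Teq)
  ultimately show "hessenberg_banded p T" by (simp add: hessenberg_banded_def)
qed

lemma LIMSEQ_power_type_II:
  assumes nz: "\<And>i. pi_II P i \<noteq> 0" and T: "hessenberg_of_type_II P T" "hessenberg_banded p T"
    and B: "type_II_polynomials p T B" and \<psi>: "associated_measures p A B \<psi>"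
  shows "(\<lambda>n. mat_power P n i j)
    \<longlonglongrightarrow> (pi_II P i * poly (B i) 1) * (linear_form_at_1 p A \<psi> j / pi_II P j)"
proof -
  have "mat_power P n i j = pi_II P i * mixed_moment p A B \<psi> n i j / pi_II P j" for n
  proof (rule mat_power_conjugate[where R = T and S = "\<lambda>i. {..Suc i}"])
    show "mixed_moment p A B \<psi> (Suc n) i j = (\<Sum>k\<le>Suc i. T i k * mixed_moment p A B \<psi> n k j)" for n i j
      by (rule mixed_moment_Suc_left[OF \<psi> _ type_II_recursion[OF T(2) B]]) simp
    show "P i j = pi_II P i * T i j / pi_II P j" for i j
      using T(1) by (simp add: hessenberg_of_type_II_def)
    show "T i k = 0" if "k \<notin> {..Suc i}" for i k
      using T(2) that by (simp add: hessenberg_banded_def)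
  qed (simp_all add: nz mixed_moment_0[OF \<psi>])
  moreover have "(\<lambda>n. pi_II P i * mixed_moment p A B \<psi> n i j / pi_II P j)
      \<longlonglongrightarrow> pi_II P i * (poly (B i) 1 * linear_form_at_1 p A \<psi> j) / pi_II P j"
    by (intro tendsto_intros LIMSEQ_mixed_moment[OF \<psi>] nz)
  ultimately show ?thesis by (simp add: mult.assoc)
qed

lemma LIMSEQ_power_type_I:
  assumes nz: "\<And>i. pi_I P i \<noteq> 0" and T: "hessenberg_of_type_I P T" "hessenberg_banded p T"
    and A: "type_I_polynomials p T \<nu> A" and \<psi>: "associated_measures p A B \<psi>"
  shows "(\<lambda>n. mat_power P n i j)
    \<longlonglongrightarrow> (linear_form_at_1 p A \<psi> i / pi_I P i) * (pi_I P j * poly (B j) 1)"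
proof -
  let ?d = "\<lambda>i. 1 / pi_I P i"
  have "mat_power P n i j = ?d i * mixed_moment p A B \<psi> n j i / ?d j" for n
  proof (rule mat_power_conjugate[where R = "\<lambda>i j. T j i" and S = "\<lambda>i. {..i + p}"])
    show "mixed_moment p A B \<psi> (Suc n) j i = (\<Sum>k\<le>i + p. T k i * mixed_moment p A B \<psi> n j k)" for n i j
      by (rule mixed_moment_Suc_right[OF \<psi> _ type_I_recursion[OF T(2) A]]) simp_all
    show "P i j = ?d i * T j i / ?d j" for i j
    proof -
      have "P i j = T j i * pi_I P j / pi_I P i" using T(1) unfolding hessenberg_of_type_I_def by blast
      then show ?thesis by simp
    qed
    show "T k i = 0" if "k \<notin> {..i + p}" for i k
      using T(2) that by (simp add: hessenberg_banded_def)
  qed (auto simp: nz mixed_moment_0[OF \<psi>])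
  moreover have "(\<lambda>n. ?d i * mixed_moment p A B \<psi> n j i / ?d j)
      \<longlonglongrightarrow> ?d i * (poly (B j) 1 * linear_form_at_1 p A \<psi> i) / ?d j"
    by (intro tendsto_intros LIMSEQ_mixed_moment[OF \<psi>]) (simp add: nz)
  ultimately show ?thesis by (simp add: mult_ac)
qed

text \<open>
  Type II and type I differ in which of the polynomials give the left factor of the limit;
  the diagonal entries agree, because the conjugation cancels there.
\<close>

theorem theorem12:
  fixes p :: nat
    and P T :: inf_mat
    and \<alpha> :: "nat \<Rightarrow> real"
    and \<nu> :: "real mat"
    and A :: "nat \<Rightarrow> nat \<Rightarrow> real poly"
    and B :: "nat \<Rightarrow> real poly"
    and \<psi> :: "nat \<Rightarrow> real measure"
  assumes "p \<ge> 1"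
    and "(type_II_banded_stochastic p P \<and> psbf_type_II p P \<and> hessenberg_of_type_II P T) \<or>
         (type_I_banded_stochastic p P \<and> psbf_type_I p P \<and> hessenberg_of_type_I P T)"
    and "positive_bidiagonal_factorization p T \<alpha>"
    and "admissible_initial_matrix p \<alpha> \<nu>"
    and "type_II_polynomials p T B"
    and "type_I_polynomials p T \<nu> A"
    and "associated_measures p A B \<psi>"
  shows "(ergodic_chain P \<longleftrightarrow>
            measure (\<psi> 1) {1} > 0 \<and> (\<forall>a\<in>{2..p}. measure (\<psi> a) {1} \<ge> 0)) \<and>
         (ergodic_chain P \<longrightarrow>
            (\<forall>q. stationary_distribution P q \<longleftrightarrow>
               q = (\<lambda>n. (\<Sum>a\<in>{1..p}. poly (A a n) 1 * measure (\<psi> a) {1}) * poly (B n) 1)))"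
proof -
  let ?Q = "linear_form_at_1 p A \<psi>"
  obtain h w where chain: "irreducible_chain P"
    and lim: "\<And>i j. (\<lambda>n. mat_power P n i j) \<longlonglongrightarrow> h i * w j"
    and diag: "\<And>j. h j * w j = ?Q j * poly (B j) 1"
  proof -
    consider (II) "type_II_banded_stochastic p P" "psbf_type_II p P" "hessenberg_of_type_II P T"
      | (I) "type_I_banded_stochastic p P" "psbf_type_I p P" "hessenberg_of_type_I P T"
      using assms(2) by blast
    then show thesis
    proof cases
      case II
      have P: "stochastic_matrix P" "\<And>i j. j > i + 1 \<or> j + p < i \<Longrightarrow> P i j = 0"
        using II(1) by (auto simp: type_II_banded_stochastic_def)
      note pos = psbf_type_II_neighbours_pos[OF \<open>p \<ge> 1\<close> II(2)]
      note T = hessenberg_of_type_II_banded[OF P(2) pos(1) II(3)]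
      show thesis
      proof (rule that)
        show "irreducible_chain P"
          using P \<open>p \<ge> 1\<close> pos by (intro irreducible_chain_banded[of P p]) auto
        show "(\<lambda>n. mat_power P n i j) \<longlonglongrightarrow> (pi_II P i * poly (B i) 1) * (?Q j / pi_II P j)" for i j
          by (rule LIMSEQ_power_type_II[OF T(1) II(3) T(2) assms(5,7)])
        show "(pi_II P j * poly (B j) 1) * (?Q j / pi_II P j) = ?Q j * poly (B j) 1" for j
          using T(1) by simp
      qed
    next
      case I
      have P: "stochastic_matrix P" "\<And>i j. j > i + p \<or> j + 1 < i \<Longrightarrow> P i j = 0"
        using I(1) by (auto simp: type_I_banded_stochastic_def)
      note pos = psbf_type_I_neighbours_pos[OF \<open>p \<ge> 1\<close> I(2)]
      note T = hessenberg_of_type_I_banded[OF P(2) pos(2) I(3)]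
      show thesis
      proof (rule that)
        show "irreducible_chain P"
          using P \<open>p \<ge> 1\<close> pos by (intro irreducible_chain_banded[of P p]) auto
        show "(\<lambda>n. mat_power P n i j) \<longlonglongrightarrow> (?Q i / pi_I P i) * (pi_I P j * poly (B j) 1)" for i j
          by (rule LIMSEQ_power_type_I[OF T(1) I(3) T(2) assms(6,7)])
        show "(?Q j / pi_I P j) * (pi_I P j * poly (B j) 1) = ?Q j * poly (B j) 1" for j
          using T(1) by simp
      qed
    qed
  qed
  interpret irreducible_chain P by (rule chain)
  have "lower_unitriangular p \<nu>" using assms(4) by (simp add: admissible_initial_matrix_def)
  from linear_form_at_1_0[OF assms(1) this assms(6)]
  have "h 0 * w 0 = measure (\<psi> 1) {1}"
    using assms(5) by (simp add: diag type_II_polynomials_def)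
  then have erg: "ergodic_chain P \<longleftrightarrow> measure (\<psi> 1) {1} > 0"
    and stat: "measure (\<psi> 1) {1} > 0 \<Longrightarrow> stationary_distribution P q \<longleftrightarrow> q = (\<lambda>j. h j * w j)" for q
    using ergodic_chain_iff[OF lim, of 0] stationary_distribution_iff[OF lim, of 0] by auto
  show ?thesis
    unfolding erg using stat by (simp add: diag linear_form_at_1_def)
qed

end
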